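(* Let $R$ be a commutative reduced ring with unity which is not an integral domain, and suppose that the zero ideal of $R$ is a fixed-place ideal. Then: (a) $\mathrm{dt}_t(\mathbb{AG}(R)) = |\mathcal{B}(R)|$. (b) If $|\mathrm{Min}(R)| > 2$, then $\mathrm{dt}(\mathbb{AG}(R)) = |\mathcal{B}(R)|$.
   Context: For $S\subseteq R$, $\mathrm{Ann}(S)=\{x\in R: Sx=\{0\}\}$. $\mathbb{A}(R)^*$ is the set of non-zero ideals $I$ of $R$ with $\mathrm{Ann}(I)\neq\{0\}$; the annihilating-ideal graph $\mathbb{AG}(R)$ has vertex set $\mathbb{A}(R)^*$, distinct $I,J$ being adjacent iff $IJ=\{0\}$. $\mathrm{Min}(R)$ is the set of minimal prime ideals of $R$. $\mathcal{B}(R)$ is the set of prime ideals $P$ of $R$ with $P=\mathrm{Ann}(x)$ for some $x\in R$. A prime $P_\circ\in\mathrm{Min}(R)$ is irredundant with respect to the zero ideal if $\bigcap_{P_\circ\neq P\in \mathrm{Min}(R)}P\neq\{0\}$; the zero ideal is a fixed-place ideal if it equals the intersection of all such irredundant primes, equivalently $\bigcap\mathcal{B}(R)=\{0\}$ (empty intersection being $R$). For a graph $G$, a dominating set is a set $D$ of vertices such that every vertex is in $D$ or adjacent to some vertex of $D$; a total dominating set is a set $S$ of vertices such that every vertex is adjacent to some vertex of $S$; $\mathrm{dt}(G)$ and $\mathrm{dt}_t(G)$ are the minimum cardinalities (possibly infinite cardinals) of a dominating set and of a total dominating set, respectively. *)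

theory Defs
  imports "HOL-Algebra.Ideal_Product"
begin

unbundle cardinal_syntax

text \<open>Graphs are simple and undirected and may be infinite; the adjacency predicate is meant to be
  symmetric, irreflexive and to hold between vertices only.\<close>

record 'v graph =
  vertices :: "'v set"
  adj :: "'v \<Rightarrow> 'v \<Rightarrow> bool"

definition dominating_set :: "('v, 'm) graph_scheme \<Rightarrow> 'v set \<Rightarrow> bool" where
  "dominating_set G D \<longleftrightarrow>
     D \<subseteq> vertices G \<and> (\<forall>v \<in> vertices G. v \<in> D \<or> (\<exists>u \<in> D. adj G v u))"

definition total_dominating_set :: "('v, 'm) graph_scheme \<Rightarrow> 'v set \<Rightarrow> bool" where
  "total_dominating_set G S \<longleftrightarrow>
     S \<subseteq> vertices G \<and> (\<forall>v \<in> vertices G. \<exists>u \<in> S. adj G v u)"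

text \<open>The minimum of the cardinals \<open>|A|\<close> for \<open>A\<close> in a nonempty family, determined up to \<open>=o\<close>.
  For the empty family the value is unspecified.\<close>

definition min_card :: "'v set set \<Rightarrow> 'v rel" where
  "min_card F = (SOME r. r \<in> card_of ` F \<and> (\<forall>A \<in> F. r \<le>o |A| ))"

definition domination_number :: "('v, 'm) graph_scheme \<Rightarrow> 'v rel" where
  "domination_number G = min_card {D. dominating_set G D}"

definition total_domination_number :: "('v, 'm) graph_scheme \<Rightarrow> 'v rel" where
  "total_domination_number G = min_card {S. total_dominating_set G S}"

lemma min_card_props:
  assumes "F \<noteq> {}"
  shows "\<exists>A \<in> F. min_card F = |A|" and "\<And>A. A \<in> F \<Longrightarrow> min_card F \<le>o |A|"
proof -
  have "\<exists>r \<in> card_of ` F. \<forall>r' \<in> card_of ` F. r \<le>o r'"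
    using assms by (intro exists_minim_Card_order) (auto simp: card_of_Card_order)
  then have "\<exists>r. r \<in> card_of ` F \<and> (\<forall>A \<in> F. r \<le>o |A| )"
    by auto
  from someI_ex[OF this] have *: "min_card F \<in> card_of ` F \<and> (\<forall>A \<in> F. min_card F \<le>o |A| )"
    unfolding min_card_def .
  from * show "\<exists>A \<in> F. min_card F = |A|" by auto
  from * show "\<And>A. A \<in> F \<Longrightarrow> min_card F \<le>o |A|" by auto
qed

lemma dominating_set_vertices: "dominating_set G (vertices G)"
  by (simp add: dominating_set_def)

lemma total_dominating_set_vertices:
  assumes "\<And>v. v \<in> vertices G \<Longrightarrow> \<exists>u \<in> vertices G. adj G v u"
  shows "total_dominating_set G (vertices G)"
  using assms by (simp add: total_dominating_set_def)

definition reduced_ring :: "('a, 'm) ring_scheme \<Rightarrow> bool" where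
  "reduced_ring R \<longleftrightarrow>
     (\<forall>x \<in> carrier R. \<forall>n::nat. x [^]\<^bsub>R\<^esub> n = \<zero>\<^bsub>R\<^esub> \<longrightarrow> x = \<zero>\<^bsub>R\<^esub>)"

definition Ann :: "('a, 'm) ring_scheme \<Rightarrow> 'a set \<Rightarrow> 'a set" where
  "Ann R S = {x \<in> carrier R. \<forall>s \<in> S. s \<otimes>\<^bsub>R\<^esub> x = \<zero>\<^bsub>R\<^esub>}"

definition annihilating_ideals :: "('a, 'm) ring_scheme \<Rightarrow> 'a set set" where
  "annihilating_ideals R = {I. ideal I R \<and> I \<noteq> {\<zero>\<^bsub>R\<^esub>} \<and> Ann R I \<noteq> {\<zero>\<^bsub>R\<^esub>}}"

definition AG :: "('a, 'm) ring_scheme \<Rightarrow> 'a set graph" where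
  "AG R = \<lparr> vertices = annihilating_ideals R,
            adj = (\<lambda>I J. I \<in> annihilating_ideals R \<and> J \<in> annihilating_ideals R \<and>
                         I \<noteq> J \<and> I \<cdot>\<^bsub>R\<^esub> J = {\<zero>\<^bsub>R\<^esub>}) \<rparr>"

definition Min_primes :: "('a, 'm) ring_scheme \<Rightarrow> 'a set set" where
  "Min_primes R = {P. primeideal P R \<and> (\<forall>Q. primeideal Q R \<and> Q \<subseteq> P \<longrightarrow> Q = P)}"

definition B_primes :: "('a, 'm) ring_scheme \<Rightarrow> 'a set set" where
  "B_primes R = {P. primeideal P R \<and> (\<exists>x \<in> carrier R. P = Ann R {x})}"

text \<open>Intersecting with the carrier makes the empty intersection the whole ring.\<close>

definition Inter_in :: "('a, 'm) ring_scheme \<Rightarrow> 'a set set \<Rightarrow> 'a set" where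
  "Inter_in R F = carrier R \<inter> \<Inter>F"

definition irredundant_primes :: "('a, 'm) ring_scheme \<Rightarrow> 'a set set" where
  "irredundant_primes R =
     {P0 \<in> Min_primes R. Inter_in R {P \<in> Min_primes R. P \<noteq> P0} \<noteq> {\<zero>\<^bsub>R\<^esub>}}"

definition zero_ideal_fixed_place :: "('a, 'm) ring_scheme \<Rightarrow> bool" where
  "zero_ideal_fixed_place R \<longleftrightarrow> Inter_in R (irredundant_primes R) = {\<zero>\<^bsub>R\<^esub>}"

lemma (in cring) ideal_Ann:
  assumes "ideal I R"
  shows "ideal (Ann R I) R"
proof -
  interpret I: ideal I R by fact
  have zero: "\<zero> \<in> Ann R I"
    using I.Icarr by (simp add: Ann_def)
  have minus: "inv\<^bsub>add_monoid R\<^esub> a \<in> Ann R I" if "a \<in> Ann R I" for a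
  proof -
    have "\<ominus> a \<in> Ann R I"
      using that I.Icarr by (simp add: Ann_def r_minus)
    then show ?thesis by (simp add: a_inv_def)
  qed
  have add: "a \<oplus> b \<in> Ann R I" if "a \<in> Ann R I" "b \<in> Ann R I" for a b
    using that I.Icarr by (simp add: Ann_def r_distr)
  have sub: "subgroup (Ann R I) (add_monoid R)"
  proof (rule add.subgroupI)
    show "Ann R I \<subseteq> carrier R" by (auto simp: Ann_def)
    show "Ann R I \<noteq> {}" using zero by blast
  qed (use minus add in \<open>simp_all add: a_inv_def\<close>)
  have l: "x \<otimes> a \<in> Ann R I" if "a \<in> Ann R I" "x \<in> carrier R" for a x
  proof -
    have "s \<otimes> (x \<otimes> a) = \<zero>" if "s \<in> I" for s
      using \<open>a \<in> Ann R I\<close> \<open>x \<in> carrier R\<close> that I.Icarr[OF that]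
        m_lcomm[of s x a] by (simp add: Ann_def)
    then show ?thesis using that by (simp add: Ann_def)
  qed
  have r: "a \<otimes> x \<in> Ann R I" if "a \<in> Ann R I" "x \<in> carrier R" for a x
  proof -
    have "a \<in> carrier R" using that by (simp add: Ann_def)
    then show ?thesis using l[OF that] that m_comm[of a x] by simp
  qed
  show ?thesis by (rule idealI[OF ring_axioms sub l r])
qed

lemma (in cring) AG_total_dominating_set:
  assumes "reduced_ring R"
  shows "total_dominating_set (AG R) (vertices (AG R))"
proof (rule total_dominating_set_vertices)
  fix I assume "I \<in> vertices (AG R)"
  then have I: "ideal I R" "I \<noteq> {\<zero>}" "Ann R I \<noteq> {\<zero>}"
    by (auto simp: AG_def annihilating_ideals_def)
  interpret I: ideal I R by (rule I)
  interpret A: ideal "Ann R I" R by (rule ideal_Ann[OF I(1)])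
  obtain i where i: "i \<in> I" "i \<noteq> \<zero>" using I(2) I.zero_closed by blast
  have ic: "i \<in> carrier R" using i(1) by (rule I.Icarr)
  have "a \<otimes> i = \<zero>" if "a \<in> Ann R I" for a
  proof -
    have "a \<in> carrier R" and "i \<otimes> a = \<zero>"
      using that i(1) unfolding Ann_def by blast+
    then show ?thesis using m_comm[OF _ ic] by metis
  qed
  then have "i \<in> Ann R (Ann R I)" using ic unfolding Ann_def by blast
  then have "Ann R (Ann R I) \<noteq> {\<zero>}" using i by blast
  then have A: "Ann R I \<in> annihilating_ideals R"
    using A.is_ideal I(3) by (simp add: annihilating_ideals_def)
  have "i \<notin> Ann R I"
  proof
    assume "i \<in> Ann R I"
    then have "i \<otimes> i = \<zero>" using i(1) unfolding Ann_def by blast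
    then have "i [^] (2::nat) = \<zero>" using ic by (simp add: numeral_2_eq_2)
    then show False using assms ic i(2) unfolding reduced_ring_def by blast
  qed
  then have neq: "I \<noteq> Ann R I" using i(1) by blast
  have "s = \<zero>" if "s \<in> I \<cdot> Ann R I" for s
    using that
  proof induct
    case (prod i j)
    then show ?case unfolding Ann_def by blast
  qed simp
  moreover have "\<zero> \<in> I \<cdot> Ann R I"
    using ideal_prod.prod[OF I.zero_closed A.zero_closed, of R] by simp
  ultimately have "I \<cdot> Ann R I = {\<zero>}" by blast
  then show "\<exists>J \<in> vertices (AG R). adj (AG R) I J"
    using A I neq by (intro bexI[of _ "Ann R I"]) (simp_all add: AG_def annihilating_ideals_def)
qed

end

theory Submission
  imports Defs
begin

text \<open>A prime \<open>P = Ann x\<close> in \<open>\<B>(R)\<close> has \<open>x \<notin> P\<close>, so an ideal killed by a nonzero element outside \<open>P\<close>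
  lies in \<open>P\<close> and is adjacent to \<open>Ann P\<close>; as the members of \<open>\<B>(R)\<close> intersect in zero, the ideals
  \<open>Ann P\<close> form a total dominating set. Conversely, members of \<open>\<B>(R)\<close> are pairwise incomparable, so
  a nonzero element cannot annihilate two of them, and choosing for each \<open>P\<close> a neighbour in a total
  dominating set is injective. For plain domination one may choose \<open>P\<close> itself when it is available;
  injectivity then fails only if \<open>PQ = 0\<close> for distinct \<open>P, Q\<close>, in which case
  every minimal prime is \<open>P\<close> or \<open>Q\<close>.\<close>

text \<open>By antisymmetry of \<open>\<le>o\<close>: the minimum is attained by some member of
  \<open>F\<close>, hence bounded below by \<open>|B|\<close>, while the witness \<open>U\<close>
  bounds it above.\<close>

lemma min_card_ordIso:
  assumes U: "U \<in> F" "|U| \<le>o |B|" and lower: "\<And>A. A \<in> F \<Longrightarrow> |B| \<le>o |A|"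
  shows "min_card F =o |B|"
proof -
  have "F \<noteq> {}" using U(1) by blast
  then obtain A where "A \<in> F" "min_card F = |A|" using min_card_props(1) by blast
  then have "|B| \<le>o min_card F" using lower by simp
  moreover have "min_card F \<le>o |B|"
    using min_card_props(2)[OF \<open>F \<noteq> {}\<close> U(1)] U(2) ordLeq_transitive by blast
  ultimately show ?thesis by (simp add: ordIso_iff_ordLeq)
qed

context cring
begin

section \<open>Zero products and reducedness\<close>

lemma ideal_prod_eq_zero_iff:
  assumes "ideal I R" "ideal J R"
  shows "I \<cdot> J = {\<zero>} \<longleftrightarrow> (\<forall>i \<in> I. \<forall>j \<in> J. i \<otimes> j = \<zero>)"
proof
  assume "I \<cdot> J = {\<zero>}"
  then show "\<forall>i \<in> I. \<forall>j \<in> J. i \<otimes> j = \<zero>"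
    using ideal_prod.prod[of _ I _ J R] by blast
next
  assume *: "\<forall>i \<in> I. \<forall>j \<in> J. i \<otimes> j = \<zero>"
  have "s = \<zero>" if "s \<in> I \<cdot> J" for s
    using that by induct (use * in auto)
  moreover have "\<zero> \<in> I \<cdot> J"
    using ideal_prod.prod[of \<zero> I \<zero> J R] assms
    by (simp add: additive_subgroup.zero_closed ideal.axioms(1))
  ultimately show "I \<cdot> J = {\<zero>}" by blast
qed

lemma reduced_ring_square:
  assumes "reduced_ring R" "x \<in> carrier R" "x \<otimes> x = \<zero>"
  shows "x = \<zero>"
proof -
  have "x [^] (2::nat) = \<zero>" using assms by (simp add: numeral_2_eq_2)
  then show ?thesis using assms unfolding reduced_ring_def by blast
qed

lemma ideal_nonzero_elem:
  assumes "ideal I R" "I \<noteq> {\<zero>}"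
  obtains a where "a \<in> I" "a \<in> carrier R" "a \<noteq> \<zero>"
  using assms additive_subgroup.zero_closed[OF ideal.axioms(1)[OF assms(1)]]
    ideal.Icarr[OF assms(1)] by blast

section \<open>Primes that are annihilators of an element\<close>

lemma B_primesE:
  assumes "reduced_ring R" "P \<in> B_primes R"
  obtains x where "x \<in> carrier R" "x \<noteq> \<zero>" "x \<notin> P" "P = Ann R {x}"
proof -
  obtain x where x: "primeideal P R" "x \<in> carrier R" "P = Ann R {x}"
    using assms(2) by (auto simp: B_primes_def)
  interpret primeideal P R by (rule x)
  have "x \<noteq> \<zero>"
  proof
    assume "x = \<zero>"
    then have "P = carrier R" unfolding x(3) by (auto simp: Ann_def)
    then show False using I_notcarr by simp
  qed
  \<comment> \<open>Reducedness enters here: \<open>x\<close> in its own annihilator would have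
    square zero.\<close>
  moreover have "x \<notin> P"
  proof
    assume "x \<in> P"
    then have "x \<otimes> x = \<zero>" unfolding x(3) by (simp add: Ann_def)
    then show False using reduced_ring_square[OF assms(1) x(2)] \<open>x \<noteq> \<zero>\<close> by simp
  qed
  ultimately show thesis using that x by blast
qed

lemma B_primes_primeideal: "P \<in> B_primes R \<Longrightarrow> primeideal P R"
  by (simp add: B_primes_def)

text \<open>With \<open>P = Ann R {x}\<close>, every \<open>y\<close> in \<open>P\<close> satisfies
  \<open>x \<otimes> y = \<zero>\<close>, which lies in \<open>Q\<close>. As \<open>x\<close> is
  outside \<open>P\<close>, hence outside \<open>Q\<close>, primeness of \<open>Q\<close> puts
  \<open>y\<close> there.\<close>

lemma B_primes_minimal:
  assumes "reduced_ring R" "P \<in> B_primes R" "primeideal Q R" "Q \<subseteq> P"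
  shows "Q = P"
proof
  obtain x where x: "x \<in> carrier R" "x \<notin> P" "P = Ann R {x}"
    using B_primesE[OF assms(1,2)] by metis
  interpret Q: primeideal Q R by fact
  show "P \<subseteq> Q"
  proof
    fix y assume "y \<in> P"
    then have "y \<in> carrier R" "x \<otimes> y = \<zero>" unfolding x(3) by (auto simp: Ann_def)
    then show "y \<in> Q" using Q.I_prime[OF x(1), of y] x(2) assms(4) Q.zero_closed by auto
  qed
qed fact

text \<open>Irredundancy of \<open>P\<close> supplies a nonzero \<open>x\<close> in all other
  minimal primes. Then \<open>P = Ann R {x}\<close>: for \<open>y\<close> in \<open>P\<close> the
  product with \<open>x\<close> lies in every minimal prime, so it vanishes.\<close>

lemma irredundant_primes_subset_B_primes:
  assumes "zero_ideal_fixed_place R"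
  shows "irredundant_primes R \<subseteq> B_primes R"
proof
  fix P assume P: "P \<in> irredundant_primes R"
  then have "primeideal P R" "P \<in> Min_primes R"
    by (auto simp: irredundant_primes_def Min_primes_def)
  then interpret P: primeideal P R by simp
  \<comment> \<open>Irredundant primes are minimal, so the fixed-place hypothesis already forces the
    minimal primes to intersect in zero.\<close>
  have zero: "z = \<zero>" if "z \<in> carrier R" "\<forall>Q \<in> Min_primes R. z \<in> Q" for z
    using assms that by (auto simp: zero_ideal_fixed_place_def Inter_in_def irredundant_primes_def)
  have ideal: "ideal Q R" if "Q \<in> Min_primes R" for Q
    using that by (simp add: Min_primes_def primeideal.axioms(1))
  have "\<zero> \<in> Inter_in R {Q \<in> Min_primes R. Q \<noteq> P}"
    using ideal by (auto simp: Inter_in_def additive_subgroup.zero_closed ideal.axioms(1))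
  then obtain x where x: "x \<in> carrier R" "x \<noteq> \<zero>" "\<And>Q. Q \<in> Min_primes R \<Longrightarrow> Q \<noteq> P \<Longrightarrow> x \<in> Q"
    using P by (auto simp: irredundant_primes_def Inter_in_def)
  have "x \<notin> P" using zero[OF x(1)] x by metis
  have "P = Ann R {x}"
  proof (intro subset_antisym subsetI)
    fix y assume y: "y \<in> P"
    then have yc: "y \<in> carrier R" by (rule P.Icarr)
    have "x \<otimes> y \<in> Q" if "Q \<in> Min_primes R" for Q
    proof (cases "Q = P")
      case True then show ?thesis using P.I_l_closed[OF y x(1)] by simp
    next
      case False
      then show ?thesis using ideal.I_r_closed[OF ideal[OF that] x(3)[OF that False] yc] by simp
    qed
    then show "y \<in> Ann R {x}" using zero x(1) yc by (simp add: Ann_def)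
  next
    fix y assume "y \<in> Ann R {x}"
    then show "y \<in> P"
      using P.I_prime[OF x(1), of y] \<open>x \<notin> P\<close> P.zero_closed by (auto simp: Ann_def)
  qed
  then show "P \<in> B_primes R"
    using \<open>primeideal P R\<close> x(1) by (auto simp: B_primes_def)
qed

lemma fixed_place_B_primes:
  assumes "zero_ideal_fixed_place R" "y \<in> carrier R" "y \<noteq> \<zero>"
  obtains P where "P \<in> B_primes R" "y \<notin> P"
proof -
  have "y \<notin> Inter_in R (irredundant_primes R)"
    using assms by (simp add: zero_ideal_fixed_place_def)
  then show thesis
    using that assms(2) irredundant_primes_subset_B_primes[OF assms(1)]
    by (auto simp: Inter_in_def)
qed

text \<open>If \<open>P\<close> and \<open>Q\<close> differ, minimality of \<open>Q\<close> gives
  some \<open>b\<close> in \<open>P\<close> outside \<open>Q\<close>. From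
  \<open>a \<otimes> b = \<zero>\<close> it follows that \<open>a\<close> is in \<open>Q\<close>, so
  \<open>a\<close> kills itself, against reducedness.\<close>

lemma annihilates_two_B_primes:
  assumes "reduced_ring R" "P \<in> B_primes R" "Q \<in> B_primes R"
    and a: "a \<in> carrier R" "a \<noteq> \<zero>"
    and kill: "\<And>p. p \<in> P \<Longrightarrow> a \<otimes> p = \<zero>" "\<And>q. q \<in> Q \<Longrightarrow> a \<otimes> q = \<zero>"
  shows "P = Q"
proof (rule ccontr)
  assume "P \<noteq> Q"
  interpret P: primeideal P R using assms(2) by (rule B_primes_primeideal)
  interpret Q: primeideal Q R using assms(3) by (rule B_primes_primeideal)
  obtain b where b: "b \<in> P" "b \<notin> Q"
    using B_primes_minimal[OF assms(1,3) P.primeideal_axioms] \<open>P \<noteq> Q\<close> by blast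
  have "a \<in> Q"
    using Q.I_prime[OF a(1) P.Icarr[OF b(1)]] kill(1)[OF b(1)] b(2) Q.zero_closed by auto
  then show False using kill(2) reduced_ring_square[OF assms(1) a(1)] a(2) by blast
qed

text \<open>The generator \<open>x\<close> of the annihilator is a nonzero element of
  \<open>Ann R P\<close>, and \<open>P\<close> itself sits inside
  \<open>Ann R (Ann R P)\<close>.\<close>

lemma B_primes_vertices:
  assumes "reduced_ring R" "\<not> domain R" "P \<in> B_primes R"
  shows "P \<in> annihilating_ideals R" "Ann R P \<in> annihilating_ideals R"
proof -
  obtain x where x: "x \<in> carrier R" "x \<noteq> \<zero>" "P = Ann R {x}"
    using B_primesE[OF assms(1,3)] by metis
  interpret P: primeideal P R using assms(3) by (rule B_primes_primeideal)
  \<comment> \<open>A prime zero ideal would make \<open>R\<close> a domain.\<close>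
  have nz: "P \<noteq> {\<zero>}" using zeroprimeideal_domainI assms(2) P.primeideal_axioms by blast
  have "x \<in> Ann R P" using x m_comm unfolding x(3) by (auto simp: Ann_def)
  then have xA: "Ann R P \<noteq> {\<zero>}" using x(2) by blast
  have "P \<subseteq> Ann R (Ann R P)" using P.Icarr m_comm by (fastforce simp: Ann_def)
  then have "Ann R (Ann R P) \<noteq> {\<zero>}" using nz P.zero_closed by blast
  then show "P \<in> annihilating_ideals R" "Ann R P \<in> annihilating_ideals R"
    using nz xA P.is_ideal ideal_Ann[OF P.is_ideal] by (auto simp: annihilating_ideals_def)
qed

section \<open>Upper bound: an explicit total dominating set\<close>

lemma total_dominating_Ann_B_primes:
  assumes "reduced_ring R" "\<not> domain R" "zero_ideal_fixed_place R"
  shows "total_dominating_set (AG R) (Ann R ` B_primes R)"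
  unfolding total_dominating_set_def
proof (intro conjI ballI)
  show "Ann R ` B_primes R \<subseteq> vertices (AG R)"
    using B_primes_vertices(2)[OF assms(1,2)] by (auto simp: AG_def)
  fix I assume "I \<in> vertices (AG R)"
  then have I: "I \<in> annihilating_ideals R" and iI: "ideal I R" and An: "Ann R I \<noteq> {\<zero>}"
    by (auto simp: AG_def annihilating_ideals_def)
  obtain y where y: "y \<in> Ann R I" "y \<in> carrier R" "y \<noteq> \<zero>"
    using ideal_nonzero_elem[OF ideal_Ann[OF iI] An] by metis
  obtain P where P: "P \<in> B_primes R" "y \<notin> P"
    using fixed_place_B_primes[OF assms(3) y(2,3)] by metis
  interpret P: primeideal P R using P(1) by (rule B_primes_primeideal)
  have sub: "I \<subseteq> P"
  proof
    fix i assume "i \<in> I"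
    then have "i \<in> carrier R" "i \<otimes> y = \<zero>"
      using y(1) ideal.Icarr[OF iI] by (auto simp: Ann_def)
    then show "i \<in> P" using P.I_prime[of i y] y(2) P(2) P.zero_closed by auto
  qed
  obtain x where x: "x \<in> carrier R" "x \<notin> P" "P = Ann R {x}"
    using B_primesE[OF assms(1) P(1)] by metis
  have "x \<in> Ann R P" using x(1) m_comm unfolding x(3) by (auto simp: Ann_def)
  \<comment> \<open>Adjacency requires distinct ideals: \<open>x\<close> lies in
    \<open>Ann R P\<close> but not in \<open>P\<close>, which contains \<open>I\<close>.\<close>
  then have "I \<noteq> Ann R P" using sub x(2) by blast
  moreover have "I \<cdot> Ann R P = {\<zero>}"
    using sub by (subst ideal_prod_eq_zero_iff[OF iI ideal_Ann[OF P.is_ideal]]) (auto simp: Ann_def)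
  ultimately show "\<exists>u \<in> Ann R ` B_primes R. adj (AG R) I u"
    using P(1) I B_primes_vertices(2)[OF assms(1,2) P(1)] by (auto simp: AG_def)
qed

section \<open>Lower bounds: injective choice of neighbours\<close>

lemma AG_adj_annihilates:
  assumes "adj (AG R) P u"
  obtains a where "a \<in> carrier R" "a \<noteq> \<zero>" "a \<in> u" "\<And>p. p \<in> P \<Longrightarrow> a \<otimes> p = \<zero>"
proof -
  have *: "ideal P R" "ideal u R" "u \<noteq> {\<zero>}" "P \<cdot> u = {\<zero>}"
    using assms by (auto simp: AG_def annihilating_ideals_def)
  obtain a where "a \<in> u" "a \<in> carrier R" "a \<noteq> \<zero>"
    using ideal_nonzero_elem[OF *(2,3)] by metis
  moreover have "p \<otimes> a = \<zero>" "p \<in> carrier R" if "p \<in> P" for p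
    using that *(4) ideal_prod_eq_zero_iff[OF *(1,2)] \<open>a \<in> u\<close> ideal.Icarr[OF *(1)] by blast+
  ultimately show thesis using that m_comm by metis
qed

text \<open>Any nonzero element of the common neighbour \<open>u\<close> annihilates both
  primes.\<close>

lemma common_neighbour_B_primes:
  assumes "reduced_ring R" "P \<in> B_primes R" "Q \<in> B_primes R"
    and "adj (AG R) P u" "adj (AG R) Q u"
  shows "P = Q"
proof -
  have *: "ideal Q R" "ideal u R" "Q \<cdot> u = {\<zero>}"
    using assms(5) by (auto simp: AG_def annihilating_ideals_def)
  obtain a where a: "a \<in> carrier R" "a \<noteq> \<zero>" "a \<in> u" "\<And>p. p \<in> P \<Longrightarrow> a \<otimes> p = \<zero>"
    using AG_adj_annihilates[OF assms(4)] by metis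
  have "a \<otimes> q = \<zero>" if "q \<in> Q" for q
    using that * ideal_prod_eq_zero_iff[OF *(1,2)] a(1,3) ideal.Icarr[OF *(1)] m_comm by metis
  then show ?thesis using annihilates_two_B_primes[OF assms(1-3) a(1,2,4)] by blast
qed

lemma total_dominating_set_lower_bound:
  assumes "reduced_ring R" "\<not> domain R" "total_dominating_set (AG R) S"
  shows "|B_primes R| \<le>o |S|"
proof -
  have "\<exists>u \<in> S. adj (AG R) P u" if "P \<in> B_primes R" for P
    using assms(3) B_primes_vertices(1)[OF assms(1,2) that]
    by (auto simp: total_dominating_set_def AG_def)
  then obtain f where f: "\<And>P. P \<in> B_primes R \<Longrightarrow> f P \<in> S \<and> adj (AG R) P (f P)" by metis
  have "inj_on f (B_primes R)"
    using f common_neighbour_B_primes[OF assms(1)] by (intro inj_onI) metis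
  then show ?thesis using f by (auto simp: card_of_ordLeq[symmetric])
qed

text \<open>A minimal prime contains the zero product of \<open>P\<close> and \<open>Q\<close>,
  hence one of the factors, and by minimality equals it.\<close>

lemma adjacent_primes_Min_primes:
  assumes "primeideal P R" "primeideal Q R" "adj (AG R) P Q"
  shows "Min_primes R \<subseteq> {P, Q}"
proof
  fix M assume M: "M \<in> Min_primes R"
  then interpret M: primeideal M R by (simp add: Min_primes_def)
  interpret P: primeideal P R by fact
  interpret Q: primeideal Q R by fact
  have PQ: "p \<otimes> q = \<zero>" if "p \<in> P" "q \<in> Q" for p q
    using that assms(3) ideal_prod_eq_zero_iff[OF P.is_ideal Q.is_ideal] by (auto simp: AG_def)
  have "P \<subseteq> M \<or> Q \<subseteq> M"
    using M.I_prime PQ P.Icarr Q.Icarr M.zero_closed by (metis subsetI)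
  then show "M \<in> {P, Q}" using M assms(1,2) by (auto simp: Min_primes_def)
qed

lemma dominating_set_lower_bound:
  assumes "reduced_ring R" "\<not> domain R" "dominating_set (AG R) D"
    and Min: "infinite (Min_primes R) \<or> card (Min_primes R) > 2"
  shows "|B_primes R| \<le>o |D|"
proof -
  have nonadj: "\<not> adj (AG R) P Q" if "P \<in> B_primes R" "Q \<in> B_primes R" for P Q
  proof
    assume "adj (AG R) P Q"
    then have sub: "Min_primes R \<subseteq> {P, Q}"
      using adjacent_primes_Min_primes that B_primes_primeideal by blast
    have "card {P, Q} \<le> 2" by (simp add: card_insert_if)
    then show False
      using Min finite_subset[OF sub] card_mono[OF _ sub] by simp
  qed
  have "\<exists>u \<in> D. u = P \<or> adj (AG R) P u" if "P \<in> B_primes R" for P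
    using assms(3) B_primes_vertices(1)[OF assms(1,2) that]
    by (auto simp: dominating_set_def AG_def)
  then obtain f where f: "\<And>P. P \<in> B_primes R \<Longrightarrow> f P \<in> D \<and> (f P = P \<or> adj (AG R) P (f P))"
    by metis
  \<comment> \<open>Suppose \<open>f P = f Q\<close>. If both are fixed by \<open>f\<close>, then
    \<open>P = Q\<close>; if only one is, the two primes are adjacent, which \<open>nonadj\<close>
    excludes; otherwise they share a neighbour.\<close>
  have "inj_on f (B_primes R)"
    using f nonadj common_neighbour_B_primes[OF assms(1)] by (intro inj_onI) metis
  then show ?thesis using f by (auto simp: card_of_ordLeq[symmetric])
qed

end

theorem theorem4p4:
  fixes R :: "('a, 'm) ring_scheme" (structure)
  assumes "cring R"
    and "reduced_ring R"
    and "\<not> domain R"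
    and "zero_ideal_fixed_place R"
  shows "total_domination_number (AG R) =o |B_primes R| \<and>
         (infinite (Min_primes R) \<or> card (Min_primes R) > 2 \<longrightarrow>
            domination_number (AG R) =o |B_primes R| )"
proof -
  interpret cring R by fact
  \<comment> \<open>One witness serves both numbers, since a total dominating set is dominating;
    being an image of \<open>B_primes R\<close>, it is no larger.\<close>
  let ?U = "Ann R ` B_primes R"
  have U: "total_dominating_set (AG R) ?U"
    using assms(2-4) by (rule total_dominating_Ann_B_primes)
  then have "dominating_set (AG R) ?U"
    by (auto simp: total_dominating_set_def dominating_set_def)
  with U show ?thesis
    unfolding total_domination_number_def domination_number_def
    using total_dominating_set_lower_bound[OF assms(2,3)] dominating_set_lower_bound[OF assms(2,3)]
    by (auto intro!: min_card_ordIso[of ?U] card_of_image)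
qed

end
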